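(* There exists a finite group $G$ which is an extension of a $7$-group by a group of the form $2.S_4$ (that is, $G$ has a normal $7$-subgroup $N$ with $G/N$ of the form $2.S_4$) such that $\mu(G)=\mu(\mathrm{PGL}(2,7))=\{6,7,8\}$. In particular, the projective general linear group $\mathrm{PGL}(2,7)$ is nonrecognizable, i.e. $h(\mathrm{PGL}(2,7))=\infty$.
   Context: All groups are finite. For a group $G$, the spectrum $\omega(G)$ is the set of orders of all elements of $G$, and $\mu(G)$ is the set of elements of $\omega(G)$ that are maximal with respect to divisibility. $h(G)$ denotes the number of isomorphism classes of finite groups $H$ with $\omega(H)=\omega(G)$ (with $h(G)=\infty$ if there are infinitely many). A group $G$ is called nonrecognizable if $h(G)=\infty$. A group of the form $2.S_4$ is an extension of a group of order 2 by the symmetric group $S_4$, i.e. a group having a normal subgroup of order 2 with quotient isomorphic to $S_4$. $\mathrm{PGL}(2,7)$ is the projective general linear group of degree 2 over the field with 7 elements. *)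

theory Defs
  imports
    "HOL-Analysis.Determinants"
    "HOL-Algebra.Sym_Groups"
    "HOL-Algebra.Multiplicative_Group"
    "HOL-Library.Extended_Nat"
begin

definition spectrum :: "('a, 'b) monoid_scheme \<Rightarrow> nat set" where
  "spectrum G = {group.ord G x | x. x \<in> carrier G}"

definition mu :: "('a, 'b) monoid_scheme \<Rightarrow> nat set" where
  "mu G = {n \<in> spectrum G. \<forall>m \<in> spectrum G. n dvd m \<longrightarrow> m = n}"


(* Every finite group is isomorphic to one whose elements are natural numbers (nat_copy_exists
   below), so the finite groups of type nat monoid meet every isomorphism class. *)

definition isospectral_groups :: "('a, 'b) monoid_scheme \<Rightarrow> nat monoid set" where
  "isospectral_groups G = {H. group H \<and> finite (carrier H) \<and> spectrum H = spectrum G}"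

definition isospectral_classes :: "('a, 'b) monoid_scheme \<Rightarrow> nat monoid set set" where
  "isospectral_classes G =
     isospectral_groups G //
       {(H, K). H \<in> isospectral_groups G \<and> K \<in> isospectral_groups G \<and> H \<cong> K}"

definition num_isospectral :: "('a, 'b) monoid_scheme \<Rightarrow> enat" where
  "num_isospectral G =
     (if finite (isospectral_classes G) then enat (card (isospectral_classes G)) else \<infinity>)"

definition nonrecognizable :: "('a, 'b) monoid_scheme \<Rightarrow> bool" where
  "nonrecognizable G \<longleftrightarrow> num_isospectral G = \<infinity>"


definition finite_p_group :: "nat \<Rightarrow> ('a, 'b) monoid_scheme \<Rightarrow> bool" where
  "finite_p_group p P \<longleftrightarrow> group P \<and> finite (carrier P) \<and> (\<exists>k. order P = p ^ k)"

definition is_2_dot_S4 :: "('a, 'b) monoid_scheme \<Rightarrow> bool" where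
  "is_2_dot_S4 H \<longleftrightarrow> group H \<and> (\<exists>Z. Z \<lhd> H \<and> card Z = 2 \<and> H Mod Z \<cong> sym_group 4)"


definition GL :: "('a::comm_ring_1 ^ 'n ^ 'n) monoid" where
  "GL = \<lparr>carrier = {A. invertible A}, mult = (**), one = mat 1\<rparr>"

definition scalar_matrices :: "('a::comm_ring_1 ^ 'n ^ 'n) set" where
  "scalar_matrices = {A. invertible A \<and> (\<exists>c. A = mat c)}"

definition PGL :: "('a::comm_ring_1 ^ 'n ^ 'n) set monoid" where
  "PGL = GL Mod scalar_matrices"

(* The numeral type 7 is the ring of integers modulo 7, hence the field with 7 elements
   (see F7_field); the library makes it an instance of comm_ring_1 only. *)

abbreviation PGL_2_7 :: "(7 ^ 2 ^ 2) set monoid" where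
  "PGL_2_7 \<equiv> PGL"


lemma nat_copy_exists:
  fixes G :: "('a, 'b) monoid_scheme"
  assumes "group G" "finite (carrier G)"
  shows "\<exists>H :: nat monoid. group H \<and> finite (carrier H) \<and> G \<cong> H"
proof -
  interpret group G by fact
  obtain f :: "'a \<Rightarrow> nat" where f: "inj_on f (carrier G)"
    using finite_imp_inj_to_nat_seg[OF assms(2)] by blast
  define H where "H = \<lparr>carrier = f ` carrier G,
    mult = (\<lambda>a b. f (inv_into (carrier G) f a \<otimes>\<^bsub>G\<^esub> inv_into (carrier G) f b)),
    one = f \<one>\<^bsub>G\<^esub>\<rparr>"
  have iso: "f \<in> iso G H"
    using f by (auto simp: iso_def hom_def H_def bij_betw_def)
  have "H\<lparr>one := f \<one>\<^bsub>G\<^esub>\<rparr> = H"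
    by (simp add: H_def)
  then have "group H"
    using iso_imp_img_group[OF iso] by simp
  moreover have "finite (carrier H)"
    using assms(2) by (simp add: H_def)
  ultimately show ?thesis
    using is_isoI[OF iso] by blast
qed

lemma equiv_isospectral:
  "equiv (isospectral_groups G)
     {(H, K). H \<in> isospectral_groups G \<and> K \<in> isospectral_groups G \<and> H \<cong> K}"
proof (rule equivI)
  show "trans {(H, K). H \<in> isospectral_groups G \<and> K \<in> isospectral_groups G \<and> H \<cong> K}"
    by (rule transI) (auto intro: iso_trans)
qed (auto simp: refl_on_def isospectral_groups_def intro!: symI intro: iso_refl group.iso_sym)

lemma F7_field:
  fixes x :: 7
  assumes "x \<noteq> 0"
  shows "\<exists>y. x * y = 1"
proof -
  have "x \<in> (UNIV :: 7 set)" by simp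
  also have "(UNIV :: 7 set) = {0, 1, 2, 3, 4, 5, 6}"
  proof (rule sym, rule card_subset_eq)
    show "card {0, 1, 2, 3, 4, 5, 6 :: 7} = CARD(7)" by simp
  qed auto
  finally consider "x = 1" | "x = 2" | "x = 3" | "x = 4" | "x = 5" | "x = 6"
    using assms by auto
  then show ?thesis
  proof cases
    case 1 show ?thesis by (rule exI[of _ 1]) (simp add: 1)
  next
    case 2 show ?thesis by (rule exI[of _ 4]) (simp add: 2)
  next
    case 3 show ?thesis by (rule exI[of _ 5]) (simp add: 3)
  next
    case 4 show ?thesis by (rule exI[of _ 2]) (simp add: 4)
  next
    case 5 show ?thesis by (rule exI[of _ 3]) (simp add: 5)
  next
    case 6 show ?thesis by (rule exI[of _ 6]) (simp add: 6)
  qed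
qed

lemma group_GL: "group (GL :: ('a::comm_ring_1 ^ 'n ^ 'n) monoid)"
proof (rule groupI)
  fix A :: "'a ^ 'n ^ 'n" assume "A \<in> carrier GL"
  then obtain B where "A ** B = mat 1" "B ** A = mat 1"
    by (auto simp: GL_def invertible_def)
  then show "\<exists>B \<in> carrier GL. B \<otimes>\<^bsub>GL\<^esub> A = \<one>\<^bsub>GL\<^esub>"
    by (auto simp: GL_def invertible_def)
next
  show "\<one>\<^bsub>GL\<^esub> \<in> carrier (GL :: ('a ^ 'n ^ 'n) monoid)"
    unfolding GL_def invertible_def by (auto intro!: exI[of _ "mat 1"])
qed (auto simp: GL_def invertible_mult matrix_mul_assoc)

lemma scalar_matrices_normal:
  "scalar_matrices \<lhd> (GL :: ('a::comm_ring_1 ^ 'n ^ 'n) monoid)"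
proof -
  interpret group "GL :: ('a ^ 'n ^ 'n) monoid" by (rule group_GL)
  have comm: "A ** mat c = mat c ** A" for A :: "'a ^ 'n ^ 'n" and c
    by (vector matrix_matrix_mult_def mat_def)
       (simp add: if_distrib if_distribR mult.commute cong: if_cong)
  have mult_mat: "mat c ** mat d = (mat (c * d) :: 'a ^ 'n ^ 'n)" for c d
    by (vector matrix_matrix_mult_def mat_def)
       (simp add: if_distrib if_distribR cong: if_cong)
  have "subgroup scalar_matrices (GL :: ('a ^ 'n ^ 'n) monoid)"
  proof (rule subgroupI)
    show "scalar_matrices \<subseteq> carrier (GL :: ('a ^ 'n ^ 'n) monoid)"
      by (auto simp: scalar_matrices_def GL_def)
    show "(scalar_matrices :: ('a ^ 'n ^ 'n) set) \<noteq> {}"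
      using one_closed by (auto simp: scalar_matrices_def GL_def)
  next
    fix A :: "'a ^ 'n ^ 'n" assume A: "A \<in> scalar_matrices"
    then obtain c B where c: "A = mat c" and B: "A ** B = mat 1" "B ** A = mat 1"
      by (auto simp: scalar_matrices_def invertible_def)
    obtain i :: 'n where True by simp
    define d where "d = B $ i $ i"
    have "(mat c ** B) $ i $ i = c * d"
      by (simp add: d_def matrix_matrix_mult_def mat_def if_distribR cong: if_cong)
         (simp add: if_distrib[of "\<lambda>x. x * _"] cong: if_cong)
    then have "c * d = 1" using B(1) c by (simp add: mat_def)
    then have AD: "A ** mat d = mat 1" "mat d ** A = mat 1"
      using c by (simp_all add: mult_mat mult.commute)
    then have D: "invertible (mat d :: 'a ^ 'n ^ 'n)" unfolding invertible_def by blast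
    have "inv\<^bsub>GL\<^esub> A = mat d"
      by (rule inv_equality) (use A AD D in \<open>auto simp: GL_def scalar_matrices_def\<close>)
    then show "inv\<^bsub>GL\<^esub> A \<in> scalar_matrices"
      using D by (auto simp: scalar_matrices_def)
  next
    fix A B :: "'a ^ 'n ^ 'n" assume "A \<in> scalar_matrices" "B \<in> scalar_matrices"
    then show "A \<otimes>\<^bsub>GL\<^esub> B \<in> scalar_matrices"
      by (auto simp: scalar_matrices_def GL_def invertible_mult mult_mat
          intro: invertible_mult[of "mat _" "mat _", unfolded mult_mat])
  qed
  moreover have "x \<otimes>\<^bsub>GL\<^esub> h \<otimes>\<^bsub>GL\<^esub> inv\<^bsub>GL\<^esub> x \<in> scalar_matrices"
    if x: "x \<in> carrier GL" and h: "h \<in> scalar_matrices" for x h :: "'a ^ 'n ^ 'n"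
  proof -
    have hG: "h \<in> carrier GL" using h by (auto simp: GL_def scalar_matrices_def)
    have "x \<otimes>\<^bsub>GL\<^esub> h = h \<otimes>\<^bsub>GL\<^esub> x" using h comm by (auto simp: GL_def scalar_matrices_def)
    then have "x \<otimes>\<^bsub>GL\<^esub> h \<otimes>\<^bsub>GL\<^esub> inv\<^bsub>GL\<^esub> x = h" using x hG by (simp add: m_assoc)
    with h show ?thesis by simp
  qed
  ultimately show ?thesis by (simp add: normal_inv_iff)
qed

lemma group_PGL: "group (PGL :: ('a::comm_ring_1 ^ 'n ^ 'n) set monoid)"
  unfolding PGL_def by (rule normal.factorgroup_is_group[OF scalar_matrices_normal])

end

theory Submission
  imports Defs "HOL-Computational_Algebra.Primes"
begin

text \<open>
  The spectrum of \<open>PGL(2,7)\<close> consists of the divisors of 6, 7 and 8: by Cayley-Hamilton the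
  \<open>n\<close>-th power of a 2 by 2 matrix with trace \<open>t\<close> and determinant \<open>d\<close> is a combination of the
  matrix and the identity whose first coefficient is the Lucas number \<open>U\<^sub>n(t,d)\<close>, and for every
  \<open>t\<close> and every \<open>d \<noteq> 0\<close> in the field with 7 elements one of \<open>U\<^sub>6\<close>, \<open>U\<^sub>7\<close>, \<open>U\<^sub>8\<close> vanishes
  (\<open>spectrum_PGL_2_7\<close>).

  The same spectrum occurs for Frobenius groups. The binary octahedral group, a group \<open>2.S\<^sub>4\<close>
  with spectrum consisting of the divisors of 6 and 8, embeds in \<open>SL(2,7)\<close>. It has order 48,
  which is prime to 7, so none of its elements except the identity has trace 2, that is,
  eigenvalue 1. It therefore acts without fixed points on \<open>V = F\<^sub>7\<^sup>2\<close>, and likewise on every power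
  \<open>V\<^sup>k\<close>. In the semidirect product of \<open>V\<^sup>k\<close> with it, an element outside \<open>V\<^sup>k\<close> has the same order
  as its image in the complement, because a nontrivial power of it in \<open>V\<^sup>k\<close> would be a vector that
  this image fixes; the nontrivial elements of \<open>V\<^sup>k\<close> have order 7
  (\<open>spectrum_frobenius_group\<close>). As \<open>k\<close> varies, the orders \<open>49\<^sup>k \<cdot> 48\<close> of these groups are distinct,
  so infinitely many isomorphism classes have the spectrum of \<open>PGL(2,7)\<close>.

  The binary octahedral group is realised through its action on the four space diagonals of a
  cube. The trace-zero matrices form a three-dimensional quadratic space over the field, on which
  \<open>SL(2,7)\<close> acts by conjugation as a group of rotations; the group in question
  consists of the matrices that permute the four diagonals up to sign. The permutation of the
  diagonals is recorded together with the matrix, so that the projection to \<open>S\<^sub>4\<close> is just the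
  second component. Its kernel is \<open>{1, -1}\<close> (\<open>kernel_snd\<close>), and it is onto because every
  transposition is induced by a half turn (\<open>transposition_in_binary_octahedral\<close>).
\<close>

section \<open>Two by two matrices and Lucas sequences\<close>

lemma UNIV_F7: "(UNIV :: 7 set) = {0, 1, 2, 3, 4, 5, 6}"
proof (rule sym, rule card_subset_eq)
  show "card {0, 1, 2, 3, 4, 5, 6 :: 7} = CARD(7)" by simp
qed auto

lemma all_F7: "(\<forall>x :: 7. P x) \<longleftrightarrow> P 0 \<and> P 1 \<and> P 2 \<and> P 3 \<and> P 4 \<and> P 5 \<and> P 6"
  by (metis (mono_tags, lifting) UNIV_F7 UNIV_I empty_iff insertE)

text \<open>
  Explicit entries turn statements about matrices over the field with 7 elements into equations
  that can be decided by running through all values.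
\<close>
definition mat2 :: "'a \<Rightarrow> 'a \<Rightarrow> 'a \<Rightarrow> 'a \<Rightarrow> 'a::comm_ring_1 ^ 2 ^ 2" where
  "mat2 a b c d = vector [vector [a, b], vector [c, d]]"

lemma mat2_exhaust: obtains a b c d where "A = mat2 a b c d"
proof
  show "A = mat2 (A $ 1 $ 1) (A $ 1 $ 2) (A $ 2 $ 1) (A $ 2 $ 2)"
    by (simp add: mat2_def vec_eq_iff forall_2)
qed

lemma mat2_eq_iff [simp]:
  "mat2 a b c d = mat2 a' b' c' d' \<longleftrightarrow> a = a' \<and> b = b' \<and> c = c' \<and> d = d'"
  by (auto simp: mat2_def vec_eq_iff forall_2)

lemma mat2_mult [simp]: "mat2 a b c d ** mat2 a' b' c' d' =
    mat2 (a * a' + b * c') (a * b' + b * d') (c * a' + d * c') (c * b' + d * d')"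
  by (simp add: mat2_def vec_eq_iff forall_2 matrix_matrix_mult_def sum_2)

lemma mat2_vec [simp]: "mat2 a b c d *v vector [x, y] = vector [a * x + b * y, c * x + d * y]"
  by (simp add: mat2_def vec_eq_iff forall_2 matrix_vector_mult_def sum_2)

lemma mat_eq_mat2: "mat x = mat2 x 0 0 x"
  by (simp add: mat2_def vec_eq_iff forall_2 mat_def)

lemma uminus_mat2 [simp]: "- mat2 a b c d = mat2 (- a) (- b) (- c) (- d)"
  by (simp add: mat2_def vec_eq_iff forall_2)

lemma mat2_minus [simp]: "mat2 a b c d - mat2 a' b' c' d' = mat2 (a - a') (b - b') (c - c') (d - d')"
  by (simp add: mat2_def vec_eq_iff forall_2)

lemma det_mat2 [simp]: "det (mat2 a b c d) = a * d - b * c"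
  by (simp add: mat2_def det_2)

lemma minus_matrix_mult: "(- A) ** B = - (A ** B)" "A ** (- B) = - (A ** B)"
  for A B :: "'a::comm_ring_1 ^ 'n ^ 'n"
  by (simp_all add: matrix_matrix_mult_def vec_eq_iff sum_negf)

lemma invertible_mat2: "invertible (mat2 a b c d)" if "(a * d - b * c) * e = 1"
proof -
  have *: "a * (d * e) - b * (c * e) = 1"
    using that by (simp add: algebra_simps)
  show ?thesis
    unfolding invertible_def
    by (rule exI[of _ "mat2 (d * e) (- b * e) (- c * e) (a * e)"])
       (use * in \<open>simp add: mat_eq_mat2 algebra_simps\<close>)
qed

lemma invertible_imp_det_nz:
  fixes A :: "7 ^ 'n ^ 'n"
  assumes "invertible A"
  shows "det A \<noteq> 0"
proof -
  obtain B :: "7 ^ 'n ^ 'n" where "A ** B = mat 1" using assms unfolding invertible_def by blast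
  then have "det A * det B = 1" by (metis det_mul det_I)
  then show ?thesis by auto
qed

text \<open>
  The Lucas sequence \<open>U\<^sub>n(t,d)\<close>, equal to \<open>(\<alpha>\<^sup>n - \<beta>\<^sup>n) / (\<alpha> - \<beta>)\<close> for distinct roots \<open>\<alpha>\<close>, \<open>\<beta>\<close> of \<open>x\<^sup>2 - t x + d\<close>.
\<close>
fun lucas :: "'a::comm_ring_1 \<Rightarrow> 'a \<Rightarrow> nat \<Rightarrow> 'a" where
  "lucas t d 0 = 0"
| "lucas t d (Suc 0) = 1"
| "lucas t d (Suc (Suc n)) = t * lucas t d (Suc n) - d * lucas t d n"

text \<open>
  By Cayley-Hamilton a matrix \<open>A\<close> with trace \<open>t\<close> and determinant \<open>d\<close> satisfies
  \<open>A\<^sup>2 = t A - d\<close>, so its powers obey the recurrence of the Lucas sequence: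
  \<open>A\<^sup>n\<^sup>+\<^sup>1 = U\<^sub>n\<^sub>+\<^sub>1 A - d U\<^sub>n\<close>.
\<close>
lemma mat2_pow:
  fixes a b c d :: "'a::comm_ring_1"
  defines "U \<equiv> lucas (a + d) (a * d - b * c)"
  shows "mat2 a b c d [^]\<^bsub>GL\<^esub> Suc n =
    mat2 (U (Suc n) * a - (a * d - b * c) * U n) (U (Suc n) * b)
         (U (Suc n) * c) (U (Suc n) * d - (a * d - b * c) * U n)"
proof (induction n)
  case 0
  show ?case by (simp add: GL_def U_def mat_eq_mat2)
next
  case (Suc n)
  then show ?case by (simp add: GL_def U_def algebra_simps)
qed

lemmas mat2_pow_numeral = mat2_pow[where n = "pred_numeral k" for k, folded numeral_eq_Suc]

lemma mat2_pow_scalar: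
  assumes "lucas (a + d) (a * d - b * c) (Suc n) = 0"
  shows "mat2 a b c d [^]\<^bsub>GL\<^esub> Suc n = mat (- (a * d - b * c) * lucas (a + d) (a * d - b * c) n)"
  unfolding mat2_pow assms by (simp add: mat_eq_mat2 algebra_simps)

lemma lucas_explicit:
  "lucas t d 6 = t * (t\<^sup>2 - d) * (t\<^sup>2 - 3 * d)"
  "lucas t d 7 = t ^ 6 - 5 * t ^ 4 * d + 6 * t\<^sup>2 * d\<^sup>2 - d ^ 3"
  "lucas t d 8 = t * (t\<^sup>2 - 2 * d) * (t ^ 4 - 4 * t\<^sup>2 * d + 2 * d\<^sup>2)"
  by (simp_all add: eval_nat_numeral algebra_simps)

text \<open>
  Let \<open>\<alpha>\<close>, \<open>\<beta>\<close> be the eigenvalues. If they are distinct, \<open>U\<^sub>n\<close> vanishes once \<open>(\<alpha>/\<beta>)\<^sup>n = 1\<close>. When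
  they lie in the field with 7 elements this holds for \<open>n = 6\<close>; when they are conjugate over it,
  the ratio has norm 1 and its order divides 8. In case \<open>\<alpha> = \<beta>\<close> one has \<open>U\<^sub>n = n \<alpha>\<^sup>n\<^sup>-\<^sup>1\<close>, which
  vanishes for \<open>n = 7\<close>. There are only 42 pairs, and they are checked one by one.
\<close>
lemma lucas_678:
  fixes t d :: 7
  assumes "d \<noteq> 0"
  obtains n where "Suc n \<in> {6, 7, 8}" "lucas t d (Suc n) = 0"
proof -
  have "\<forall>t d :: 7. d \<noteq> 0 \<longrightarrow> lucas t d 6 = 0 \<or> lucas t d 7 = 0 \<or> lucas t d 8 = 0"
    unfolding lucas_explicit by (simp add: all_F7)
  then have "\<exists>n \<in> {5, 6, 7}. lucas t d (Suc n) = 0"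
    using assms by simp
  then show ?thesis using that by force
qed

text \<open>
  In determinant 1 the sharper information is needed which scalar the power is: by
  \<open>mat2_pow_scalar\<close> it is \<open>-U\<^sub>n\<close>. A double eigenvalue (necessarily 1 or \<open>-1\<close>) occurs exactly for trace
  2 or \<open>-2\<close>; in all other cases the sixth or the eighth power is the identity.
\<close>
lemma lucas_det_one:
  fixes t :: 7
  shows "t \<notin> {2, - 2} \<Longrightarrow> \<exists>n \<in> {5, 7}. lucas t 1 (Suc n) = 0 \<and> lucas t 1 n = - 1"
    and "t \<in> {2, - 2} \<Longrightarrow> lucas t 1 7 = 0 \<and> lucas t 1 6 \<in> {1, - 1}"
proof -
  have "\<forall>t :: 7. t \<notin> {2, - 2} \<longrightarrow> (\<exists>n \<in> {5, 7}. lucas t 1 (Suc n) = 0 \<and> lucas t 1 n = - 1)"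
    by (simp add: all_F7 numeral_eq_Suc)
  then show "t \<notin> {2, - 2} \<Longrightarrow> \<exists>n \<in> {5, 7}. lucas t 1 (Suc n) = 0 \<and> lucas t 1 n = - 1" by blast
  have "\<forall>t :: 7. t \<in> {2, - 2} \<longrightarrow> lucas t 1 7 = 0 \<and> lucas t 1 6 \<in> {1, - 1}"
    by (simp add: all_F7 numeral_eq_Suc)
  then show "t \<in> {2, - 2} \<Longrightarrow> lucas t 1 7 = 0 \<and> lucas t 1 6 \<in> {1, - 1}" by blast
qed

section \<open>Groups whose maximal element orders are 6, 7 and 8\<close>

lemma spectrum_dvd_closed:
  assumes "group G" "n \<in> spectrum G" "n > 0" "m dvd n"
  shows "m \<in> spectrum G"
proof -
  interpret group G by fact
  obtain x where x: "x \<in> carrier G" "n = ord x"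
    using assms by (auto simp: spectrum_def)
  obtain k where k: "n = m * k" using assms by auto
  have "ord (x [^]\<^bsub>G\<^esub> k) = m"
    using x k assms(3) ord_pow[of x k] by (metis dvd_triv_right mult_is_0 nonzero_mult_div_cancel_right not_gr_zero)
  then show ?thesis
    using x by (auto simp: spectrum_def)
qed

lemma spectrum_6_7_8:
  assumes "group G"
    and "\<And>x. x \<in> carrier G \<Longrightarrow> \<exists>n \<in> {6, 7, 8 :: nat}. x [^]\<^bsub>G\<^esub> n = \<one>\<^bsub>G\<^esub>"
    and "{6, 7, 8} \<subseteq> spectrum G"
  shows "spectrum G = {n. \<exists>m \<in> {6, 7, 8}. n dvd m}"
proof
  interpret group G by fact
  show "spectrum G \<subseteq> {n. \<exists>m \<in> {6, 7, 8}. n dvd m}"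
    using assms(2) by (auto simp: spectrum_def pow_eq_id)
  show "{n. \<exists>m \<in> {6, 7, 8}. n dvd m} \<subseteq> spectrum G"
    using assms by (auto intro: spectrum_dvd_closed[of _ 6] spectrum_dvd_closed[of _ 7] spectrum_dvd_closed[of _ 8])
qed

lemma mu_6_7_8:
  assumes "spectrum G = {n. \<exists>m \<in> {6, 7, 8}. n dvd m}"
  shows "mu G = {6, 7, 8}"
proof
  show "mu G \<subseteq> {6, 7, 8}"
  proof
    fix n assume "n \<in> mu G"
    then obtain m where "m \<in> {6, 7, 8}" "n dvd m" "m \<in> spectrum G \<longrightarrow> m = n"
      unfolding mu_def assms by auto
    then show "n \<in> {6, 7, 8}" unfolding assms by auto
  qed
  show "{6, 7, 8} \<subseteq> mu G"
  proof
    fix m :: nat assume m: "m \<in> {6, 7, 8}"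
    have "n = m" if "m dvd n" "n dvd k" "k \<in> {6, 7, 8}" for n k
    proof -
      have "m dvd k" using that by (blast intro: dvd_trans)
      then have "m = k" using m that(3) by auto
      then show ?thesis using that by (simp add: dvd_antisym)
    qed
    then show "m \<in> mu G" using m unfolding mu_def assms by auto
  qed
qed

text \<open>
  If the order were a proper divisor of \<open>n\<close>, it would divide \<open>n div p\<close> for some prime \<open>p\<close>.
\<close>
lemma (in group) ord_eqI:
  assumes x: "x \<in> carrier G" and n: "n > 0" "x [^] n = \<one>"
    and "\<And>p. prime p \<Longrightarrow> p dvd n \<Longrightarrow> x [^] (n div p) \<noteq> \<one>"
  shows "ord x = n"
proof (rule ccontr)
  assume "ord x \<noteq> n"
  moreover obtain k where k: "n = ord x * k"
    using n x by (auto simp: pow_eq_id)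
  ultimately obtain p where p: "prime p" "p dvd k"
    using prime_factor_nat[of k] by auto
  then obtain j where j: "k = p * j" by auto
  have "n div p = ord x * j"
    using p(1) by (simp add: k j prime_gt_0_nat)
  then have "x [^] (n div p) = \<one>"
    using x by (simp add: pow_eq_id)
  then show False
    using assms(4)[OF p(1)] k p(2) by simp
qed

lemma (in group) ord_eq_6_7_8:
  assumes x: "x \<in> carrier G"
  shows "x [^] (6::nat) = \<one> \<Longrightarrow> x [^] (2::nat) \<noteq> \<one> \<Longrightarrow> x [^] (3::nat) \<noteq> \<one> \<Longrightarrow> ord x = 6"
    and "x [^] (7::nat) = \<one> \<Longrightarrow> x \<noteq> \<one> \<Longrightarrow> ord x = 7"
    and "x [^] (8::nat) = \<one> \<Longrightarrow> x [^] (4::nat) \<noteq> \<one> \<Longrightarrow> ord x = 8"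
proof -
  have dvd: "p = 2 \<or> p = 3" if "prime p" "p dvd 6" for p :: nat
    using that prime_dvd_mult_iff[of p 2 3] primes_dvd_imp_eq[of p 2] primes_dvd_imp_eq[of p 3] by auto
  have dvd8: "p = 2" if "prime p" "p dvd 8" for p :: nat
    using that prime_dvd_power[of p 2 3] primes_dvd_imp_eq[of p 2] by auto
  have dvd7: "p = 7" if "prime p" "p dvd 7" for p :: nat
    using that primes_dvd_imp_eq[of p 7] by simp
  show "x [^] (6::nat) = \<one> \<Longrightarrow> x [^] (2::nat) \<noteq> \<one> \<Longrightarrow> x [^] (3::nat) \<noteq> \<one> \<Longrightarrow> ord x = 6"
    by (rule ord_eqI[OF x]) (auto dest!: dvd)
  show "x [^] (7::nat) = \<one> \<Longrightarrow> x \<noteq> \<one> \<Longrightarrow> ord x = 7"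
    by (rule ord_eqI[OF x]) (use x in \<open>auto dest!: dvd7\<close>)
  show "x [^] (8::nat) = \<one> \<Longrightarrow> x [^] (4::nat) \<noteq> \<one> \<Longrightarrow> ord x = 8"
    by (rule ord_eqI[OF x]) (auto dest!: dvd8)
qed

lemma spectrum_iso:
  assumes "group G" "group H" "G \<cong> H"
  shows "spectrum G = spectrum H"
proof -
  interpret G: group G by fact
  interpret H: group H by fact
  obtain f where f: "f \<in> iso G H" using assms(3) by (auto simp: is_iso_def)
  then interpret group_hom G H f
    using assms by (simp add: group_hom_def group_hom_axioms_def iso_def)
  have img: "f ` carrier G = carrier H" and inj: "inj_on f (carrier G)"
    using f by (auto simp: iso_def bij_betw_def)
  have "H.ord (f x) = G.ord x" if x: "x \<in> carrier G" for x
  proof -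
    have "f x [^]\<^bsub>H\<^esub> n = \<one>\<^bsub>H\<^esub> \<longleftrightarrow> x [^]\<^bsub>G\<^esub> n = \<one>\<^bsub>G\<^esub>" for n :: nat
      using inj_onD[OF inj, of "x [^]\<^bsub>G\<^esub> n" "\<one>\<^bsub>G\<^esub>"] x hom_nat_pow[OF x, of n] by auto
    then show ?thesis
      using x by (simp add: H.ord_unique G.pow_eq_id)
  qed
  then show ?thesis
    unfolding spectrum_def img[symmetric] by force
qed

section \<open>Element orders of PGL(2,7)\<close>

lemma PGL_pow_eq_one_iff:
  fixes A :: "'a::comm_ring_1 ^ 'n ^ 'n" and n :: nat
  assumes "A \<in> carrier GL"
  shows "(scalar_matrices #>\<^bsub>GL\<^esub> A) [^]\<^bsub>PGL\<^esub> n = \<one>\<^bsub>PGL\<^esub> \<longleftrightarrow> A [^]\<^bsub>GL\<^esub> n \<in> scalar_matrices"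
proof -
  interpret normal scalar_matrices "GL :: ('a ^ 'n ^ 'n) monoid" by (rule scalar_matrices_normal)
  have "(scalar_matrices #>\<^bsub>GL\<^esub> A) [^]\<^bsub>PGL\<^esub> n = scalar_matrices #>\<^bsub>GL\<^esub> (A [^]\<^bsub>GL\<^esub> n)"
    using hom_nat_pow[OF r_coset_hom_Mod assms is_group factorgroup_is_group, of n]
    by (simp add: PGL_def)
  moreover have "\<one>\<^bsub>PGL\<^esub> = (scalar_matrices :: ('a ^ 'n ^ 'n) set)"
    by (simp add: PGL_def FactGroup_def)
  moreover have "A [^]\<^bsub>GL\<^esub> n \<in> carrier GL" using assms by simp
  ultimately show ?thesis
    using coset_join1 coset_join2 subgroup_axioms by metis
qed

text \<open>
  The upper bound is \<open>lucas_678\<close>, since the class of a matrix in the projective group is killed by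
  exactly those exponents for which the power is scalar. The three orders are attained by a
  diagonal matrix with a primitive root as ratio of the eigenvalues, by a transvection, and by the
  companion matrix of the irreducible polynomial \<open>x\<^sup>2 - x + 3\<close>.
\<close>
lemma spectrum_PGL_2_7: "spectrum PGL_2_7 = {n. \<exists>m \<in> {6, 7, 8}. n dvd m}"
proof (rule spectrum_6_7_8)
  show "group PGL_2_7" by (rule group_PGL)
  interpret group PGL_2_7 by (rule group_PGL)
  interpret GL: group "GL :: (7 ^ 2 ^ 2) monoid" by (rule group_GL)
  have carrier: "X \<in> carrier PGL_2_7 \<longleftrightarrow> (\<exists>A \<in> carrier GL. X = scalar_matrices #>\<^bsub>GL\<^esub> A)" for X
    by (auto simp: PGL_def FactGroup_def RCOSETS_def)
  {
    fix X assume "X \<in> carrier PGL_2_7"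
    then obtain A where A: "A \<in> carrier GL" "X = scalar_matrices #>\<^bsub>GL\<^esub> A"
      by (auto simp: carrier)
    obtain a b c d where A': "A = mat2 a b c d" by (rule mat2_exhaust)
    have "a * d - b * c \<noteq> 0"
      using A(1) invertible_imp_det_nz[of A] by (simp add: GL_def A')
    then obtain n where n: "Suc n \<in> {6, 7, 8}" and U: "lucas (a + d) (a * d - b * c) (Suc n) = 0"
      using lucas_678[of "a * d - b * c" "a + d"] by (blast elim: lucas_678)
    have "invertible (A [^]\<^bsub>GL\<^esub> Suc n)"
      using GL.nat_pow_closed[OF A(1), of "Suc n"] by (simp add: GL_def)
    then have "A [^]\<^bsub>GL\<^esub> Suc n \<in> scalar_matrices"
      unfolding scalar_matrices_def A' mat2_pow U by (auto simp: mat_eq_mat2)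
    then have "X [^]\<^bsub>PGL\<^esub> Suc n = \<one>\<^bsub>PGL\<^esub>"
      using PGL_pow_eq_one_iff[OF A(1)] A(2) by blast
    then show "\<exists>n \<in> {6, 7, 8::nat}. X [^]\<^bsub>PGL\<^esub> n = \<one>\<^bsub>PGL\<^esub>"
      using n by blast
  }
  define coset :: "7 ^ 2 ^ 2 \<Rightarrow> (7 ^ 2 ^ 2) set" where "coset A = scalar_matrices #>\<^bsub>GL\<^esub> A" for A
  have scalar: "mat2 a b c d \<in> scalar_matrices \<longleftrightarrow> invertible (mat2 a b c d) \<and> a = d \<and> b = 0 \<and> c = 0" for a b c d :: 7
    by (auto simp: scalar_matrices_def mat_eq_mat2)
  have A6: "mat2 3 0 0 1 \<in> carrier (GL :: (7 ^ 2 ^ 2) monoid)"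
    using invertible_mat2[of 3 1 0 0 "5 :: 7"] by (simp add: GL_def)
  have A7: "mat2 1 1 0 1 \<in> carrier (GL :: (7 ^ 2 ^ 2) monoid)"
    using invertible_mat2[of 1 1 1 0 "1 :: 7"] by (simp add: GL_def)
  have A8: "mat2 0 4 1 1 \<in> carrier (GL :: (7 ^ 2 ^ 2) monoid)"
    using invertible_mat2[of 0 1 4 1 "5 :: 7"] by (simp add: GL_def)
  have in_carrier: "coset A \<in> carrier PGL_2_7" if "A \<in> carrier GL" for A
    using that carrier by (auto simp: coset_def)
  have pow: "coset A [^]\<^bsub>PGL\<^esub> n = \<one>\<^bsub>PGL\<^esub> \<longleftrightarrow> A [^]\<^bsub>GL\<^esub> n \<in> scalar_matrices" if "A \<in> carrier GL" for A and n :: nat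
    unfolding coset_def by (rule PGL_pow_eq_one_iff[OF that])
  have inv: "invertible (A [^]\<^bsub>GL\<^esub> n)" if "A \<in> carrier GL" for A :: "7 ^ 2 ^ 2" and n :: nat
    using GL.nat_pow_closed[OF that, of n] by (simp add: GL_def)
  have "ord (coset (mat2 3 0 0 1)) = 6"
    by (rule ord_eq_6_7_8(1)[OF in_carrier[OF A6]])
       (use inv[OF A6, of 6] in \<open>simp_all add: pow[OF A6] mat2_pow_numeral scalar\<close>, simp_all add: numeral_eq_Suc)
  moreover have "ord (coset (mat2 1 1 0 1)) = 7"
    using pow[OF A7, of 1] A7
    by (intro ord_eq_6_7_8(2)[OF in_carrier[OF A7]])
       (use inv[OF A7, of 7] in \<open>simp_all add: pow[OF A7] mat2_pow_numeral scalar in_carrier\<close>, simp_all add: numeral_eq_Suc)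
  moreover have "ord (coset (mat2 0 4 1 1)) = 8"
    by (rule ord_eq_6_7_8(3)[OF in_carrier[OF A8]])
       (use inv[OF A8, of 8] in \<open>simp_all add: pow[OF A8] mat2_pow_numeral scalar\<close>, simp_all add: numeral_eq_Suc)
  ultimately show "{6, 7, 8} \<subseteq> spectrum PGL_2_7"
    using in_carrier[OF A6] in_carrier[OF A7] in_carrier[OF A8] unfolding spectrum_def by force
qed

section \<open>The binary octahedral group\<close>

text \<open>
  Four matrices of trace zero that span the space diagonals of a cube. In Euclidean space,
  unit vectors along the diagonals, with suitable signs, have sum zero and pairwise scalar products
  \<open>-1/3\<close>; these matrices satisfy the corresponding relations \<open>d\<^sub>i\<^sup>2 = 1\<close>,
  \<open>d\<^sub>i d\<^sub>j + d\<^sub>j d\<^sub>i = -2/3 = 4\<close> for \<open>i \<noteq> j\<close>, and \<open>d\<^sub>1 + d\<^sub>2 + d\<^sub>3 + d\<^sub>4 = 0\<close>.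
\<close>
definition diagonal :: "nat \<Rightarrow> 7 ^ 2 ^ 2" where
  "diagonal i = (if i = 1 then mat2 1 0 0 6 else if i = 2 then mat2 2 4 1 5
    else if i = 3 then mat2 2 1 4 5 else mat2 2 2 2 5)"

text \<open>
  Conjugation by \<open>A\<close> maps the \<open>i\<close>-th diagonal, as a line, to the \<open>p i\<close>-th one. Clearing the inverse
  makes the condition meaningful for all matrices and easy to compute with.
\<close>
definition moves_diagonals :: "7 ^ 2 ^ 2 \<Rightarrow> (nat \<Rightarrow> nat) \<Rightarrow> bool" where
  "moves_diagonals A p \<longleftrightarrow> (\<forall>i \<in> {1..4}.
     A ** diagonal i = diagonal (p i) ** A \<or> A ** diagonal i = - (diagonal (p i) ** A))"

text \<open>
  The permutation is determined by the matrix; carrying it along saves defining the map to the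
  symmetric group by a choice.
\<close>
definition binary_octahedral :: "((7 ^ 2 ^ 2) \<times> (nat \<Rightarrow> nat)) monoid" where
  "binary_octahedral =
     \<lparr>carrier = {(A, p). det A = 1 \<and> p permutes {1..4} \<and> moves_diagonals A p},
      mult = (\<lambda>(A, p) (B, q). (A ** B, p \<circ> q)), one = (mat 1, id)\<rparr>"

lemma moves_diagonals_mult:
  assumes "moves_diagonals A p" "moves_diagonals B q" "q permutes {1..4}"
  shows "moves_diagonals (A ** B) (p \<circ> q)"
  unfolding moves_diagonals_def
proof
  fix i :: nat assume i: "i \<in> {1..4}"
  then have qi: "q i \<in> {1..4}" using assms(3) permutes_in_image by metis
  have B: "B ** diagonal i = diagonal (q i) ** B \<or> B ** diagonal i = - (diagonal (q i) ** B)"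
    using assms(2) i by (auto simp: moves_diagonals_def)
  have A: "A ** diagonal (q i) = diagonal (p (q i)) ** A \<or> A ** diagonal (q i) = - (diagonal (p (q i)) ** A)"
    using assms(1) qi unfolding moves_diagonals_def by blast
  from A B show "A ** B ** diagonal i = diagonal ((p \<circ> q) i) ** (A ** B) \<or>
      A ** B ** diagonal i = - (diagonal ((p \<circ> q) i) ** (A ** B))"
    by (metis (no_types, opaque_lifting) comp_apply matrix_mul_assoc minus_matrix_mult minus_minus)
qed

lemma moves_diagonals_inverse:
  assumes "moves_diagonals A p" "p permutes {1..4}" "B ** A = mat 1" "A ** B = mat 1"
  shows "moves_diagonals B (inv' p)"
  unfolding moves_diagonals_def
proof
  fix i :: nat assume i: "i \<in> {1..4}"
  define j where "j = inv' p i"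
  have j: "j \<in> {1..4}" "p j = i"
    using i assms(2) by (auto simp: j_def permutes_inverses dest: permutes_inv permutes_in_image)
       (metis atLeastAtMost_iff permutes_in_image permutes_inv)+
  have "A ** diagonal j = diagonal i ** A \<or> A ** diagonal j = - (diagonal i ** A)"
    using assms(1) j unfolding moves_diagonals_def by blast
  then have "B ** (A ** diagonal j) ** B = B ** (diagonal i ** A) ** B \<or>
     B ** (A ** diagonal j) ** B = B ** (- (diagonal i ** A)) ** B" by metis
  moreover have "B ** (A ** X) ** B = X ** B" "B ** (X ** A) ** B = B ** X" for X
    using assms(3,4) by (simp_all add: matrix_mul_assoc) (simp add: assms(4) flip: matrix_mul_assoc)
  ultimately have "diagonal j ** B = B ** diagonal i \<or> diagonal j ** B = - (B ** diagonal i)"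
    by (simp add: minus_matrix_mult)
  then show "B ** diagonal i = diagonal (inv' p i) ** B \<or>
      B ** diagonal i = - (diagonal (inv' p i) ** B)"
    unfolding j_def by auto
qed

lemma group_binary_octahedral: "group binary_octahedral"
proof (rule groupI)
  show "\<one>\<^bsub>binary_octahedral\<^esub> \<in> carrier binary_octahedral"
    by (simp add: binary_octahedral_def moves_diagonals_def permutes_id)
next
  fix x y assume "x \<in> carrier binary_octahedral" "y \<in> carrier binary_octahedral"
  then show "x \<otimes>\<^bsub>binary_octahedral\<^esub> y \<in> carrier binary_octahedral"
    by (auto simp: binary_octahedral_def det_mul moves_diagonals_mult intro: permutes_compose)
next
  fix x assume "x \<in> carrier binary_octahedral"
  then obtain A p where x: "x = (A, p)" "det A = 1" "p permutes {1..4}" "moves_diagonals A p"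
    by (auto simp: binary_octahedral_def)
  obtain a b c d where A: "A = mat2 a b c d" by (rule mat2_exhaust)
  define B where "B = mat2 d (- b) (- c) a"
  have B: "B ** A = mat 1" "A ** B = mat 1" "det B = 1"
    using x(2) by (simp_all add: A B_def mat_eq_mat2 algebra_simps)
  then have "(B, inv' p) \<in> carrier binary_octahedral" "(B, inv' p) \<otimes>\<^bsub>binary_octahedral\<^esub> x = \<one>\<^bsub>binary_octahedral\<^esub>"
    using x moves_diagonals_inverse[OF x(4,3) B(1,2)]
    by (auto simp: binary_octahedral_def permutes_inv permutes_inv_o)
  then show "\<exists>y \<in> carrier binary_octahedral. y \<otimes>\<^bsub>binary_octahedral\<^esub> x = \<one>\<^bsub>binary_octahedral\<^esub>"
    by blast
qed (auto simp: binary_octahedral_def matrix_mul_assoc comp_assoc)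

interpretation oct: group binary_octahedral by (rule group_binary_octahedral)

lemma finite_binary_octahedral: "finite (carrier binary_octahedral)"
proof (rule finite_subset)
  show "carrier binary_octahedral \<subseteq> UNIV \<times> {p. p permutes {1..4}}"
    by (auto simp: binary_octahedral_def)
qed (simp add: finite_permutations)

lemma one_binary_octahedral: "\<one>\<^bsub>binary_octahedral\<^esub> = (mat 1, id)"
  by (simp add: binary_octahedral_def)

lemma mult_binary_octahedral: "(A, p) \<otimes>\<^bsub>binary_octahedral\<^esub> (B, q) = (A ** B, p \<circ> q)"
  by (simp add: binary_octahedral_def)

lemma fst_one_binary_octahedral: "fst \<one>\<^bsub>binary_octahedral\<^esub> = mat 1"
  by (simp add: binary_octahedral_def)

lemma fst_mult_binary_octahedral: "fst (g \<otimes>\<^bsub>binary_octahedral\<^esub> h) = fst g ** fst h"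
  by (simp add: binary_octahedral_def split: prod.split)

lemma binary_octahedral_pow:
  "(A, p) [^]\<^bsub>binary_octahedral\<^esub> (n :: nat) = (A [^]\<^bsub>GL\<^esub> n, p [^]\<^bsub>sym_group 4\<^esub> n)"
  by (induction n) (simp_all add: binary_octahedral_def GL_def sym_group_def fun_eq_iff)

lemma ball_diagonals: "(\<forall>i \<in> {1..4 :: nat}. P i) \<longleftrightarrow> P 1 \<and> P 2 \<and> P 3 \<and> P 4"
proof -
  have "{1..4 :: nat} = {1, 2, 3, 4}" by auto
  then show ?thesis by simp
qed

lemma diagonal_simps [simp]:
  "diagonal 1 = mat2 1 0 0 6" "diagonal (Suc 0) = mat2 1 0 0 6" "diagonal 2 = mat2 2 4 1 5"
  "diagonal 3 = mat2 2 1 4 5" "diagonal 4 = mat2 2 2 2 5"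
  by (simp_all add: diagonal_def)

lemma diagonal_inj:
  assumes "i \<in> {1..4}" "j \<in> {1..4}" "diagonal i = diagonal j \<or> diagonal i = - diagonal j"
  shows "i = j"
proof -
  have "\<forall>i \<in> {1..4}. \<forall>j \<in> {1..4}. (diagonal i = diagonal j \<or> diagonal i = - diagonal j) \<longrightarrow> i = j"
    unfolding ball_diagonals by simp
  then show ?thesis using assms by blast
qed

text \<open>
  A scalar matrix fixes each diagonal by conjugation, and no two diagonals span the same line.
\<close>
lemma central_imp_trivial_perm:
  assumes "(A, p) \<in> carrier binary_octahedral" "A = mat 1 \<or> A = - mat 1"
  shows "p = id"
proof -
  have p: "p permutes {1..4}" "moves_diagonals A p"
    using assms by (auto simp: binary_octahedral_def)
  have "p i = i" if i: "i \<in> {1..4}" for i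
  proof -
    have "diagonal i = diagonal (p i) \<or> diagonal i = - diagonal (p i)"
    proof -
      have "A ** diagonal i = diagonal (p i) ** A \<or> A ** diagonal i = - (diagonal (p i) ** A)"
        using p(2) i unfolding moves_diagonals_def by blast
      moreover have "A ** X = X ** A" "A ** X = Y \<longleftrightarrow> X = A ** Y" for X Y :: "7 ^ 2 ^ 2"
        using assms(2) by (auto simp: minus_matrix_mult)
      moreover have "- (A ** X) = A ** (- X)" for X :: "7 ^ 2 ^ 2"
        by (simp add: minus_matrix_mult)
      moreover have "A ** (A ** X) = X" for X :: "7 ^ 2 ^ 2"
        using assms(2) by (auto simp: minus_matrix_mult)
      ultimately show ?thesis by metis
    qed
    moreover have "p i \<in> {1..4}" using i p(1) permutes_in_image by metis
    ultimately show ?thesis using diagonal_inj[OF i] by metis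
  qed
  then show ?thesis
    using p(1) by (auto simp: permutes_def fun_eq_iff)
qed

text \<open>
  The first diagonal matrix is \<open>diag(1,-1)\<close>, so a matrix that fixes its line is diagonal or
  antidiagonal. In the first case fixing the second line forces a scalar; in the second case the
  second and third lines cannot both be fixed.
\<close>
lemma trivial_perm_imp_central:
  assumes "(A, id) \<in> carrier binary_octahedral"
  shows "A = mat 1 \<or> A = - mat 1"
proof -
  obtain a b c d where A: "A = mat2 a b c d" by (rule mat2_exhaust)
  have det: "a * d - b * c = 1" and m: "moves_diagonals A id"
    using assms by (auto simp: binary_octahedral_def A)
  let ?comm = "\<lambda>i A. A ** diagonal i = diagonal i ** A \<or> A ** diagonal i = - (diagonal i ** A)"
  have m: "?comm 1 A" "?comm 2 A" "?comm 3 A"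
    using m unfolding moves_diagonals_def ball_diagonals by auto
  have "\<forall>x :: 7. (6 * x = x \<longrightarrow> x = 0) \<and> (x = - x \<longrightarrow> x = 0) \<and> (6 * x = - (6 * x) \<longrightarrow> x = 0)"
    by (simp add: all_F7)
  then have z: "\<And>x :: 7. 6 * x = x \<Longrightarrow> x = 0" "\<And>x :: 7. x = - x \<Longrightarrow> x = 0"
      "\<And>x :: 7. 6 * x = - (6 * x) \<Longrightarrow> x = 0"
    by blast+
  have "6 * b = b \<and> 6 * c = c \<or> a = - a \<and> 6 * d = - (6 * d)"
    using m(1) by (auto simp: A)
  then consider "b = 0" "c = 0" | "a = 0" "d = 0"
    using z by blast
  then show ?thesis
  proof cases
    case 1
    have "\<forall>x y :: 7. x * y = 1 \<longrightarrow> ?comm 2 (mat2 x 0 0 y) \<longrightarrow> x = y \<and> (x = 1 \<or> x = - 1)"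
      by (simp add: all_F7)
    moreover have "a * d = 1" using det 1 by simp
    moreover note m(2)[unfolded A 1]
    ultimately have "a = d \<and> (a = 1 \<or> a = - 1)" by blast
    then show ?thesis using 1 by (auto simp: A mat_eq_mat2)
  next
    case 2
    have "\<forall>x y :: 7. - (x * y) = 1 \<longrightarrow> ?comm 2 (mat2 0 x y 0) \<longrightarrow> \<not> ?comm 3 (mat2 0 x y 0)"
      by (simp add: all_F7)
    moreover have "- (b * c) = 1" using det 2 by simp
    moreover note m(2,3)[unfolded A 2]
    ultimately show ?thesis by blast
  qed
qed

text \<open>
  The trace-zero matrix \<open>u = d\<^sub>i - d\<^sub>j\<close> spans the axis through the midpoints of two opposite edges of
  the cube, and conjugation by it is the half turn about this axis. Indeed \<open>u d\<^sub>i = - d\<^sub>j u\<close>, and \<open>u\<close> anticommutes with the other two diagonals,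
  by the relations between the \<open>d\<^sub>i\<close>. Also by these, \<open>u\<^sup>2 = 2 - 4 = -2\<close>, so that \<open>2 u\<close> has square
  \<open>-8 = -1\<close> and, having trace zero, determinant 1.
\<close>
lemma transposition_in_binary_octahedral:
  assumes "i \<in> {1..4}" "j \<in> {1..4}" "i \<noteq> j"
  shows "(mat 2 ** (diagonal i - diagonal j), Transposition.transpose i j) \<in> carrier binary_octahedral"
proof -
  have "\<forall>i \<in> {1..4}. \<forall>j \<in> {1..4}. i \<noteq> j \<longrightarrow>
     det (mat 2 ** (diagonal i - diagonal j)) = 1 \<and>
     moves_diagonals (mat 2 ** (diagonal i - diagonal j)) (Transposition.transpose i j)"
    unfolding moves_diagonals_def ball_diagonals
    by (simp add: mat_eq_mat2 transpose_def)
  then show ?thesis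
    using assms permutes_swap_id[OF assms(1,2)] by (auto simp: binary_octahedral_def)
qed

section \<open>The quotient by the centre\<close>

lemma snd_hom: "snd \<in> hom binary_octahedral (sym_group 4)"
  by (auto simp: hom_def binary_octahedral_def sym_group_def)

lemma snd_surj: "snd ` carrier binary_octahedral = carrier (sym_group 4)"
proof
  show "snd ` carrier binary_octahedral \<subseteq> carrier (sym_group 4)"
    by (auto simp: binary_octahedral_def sym_group_def)
  have "\<exists>A. (A, p) \<in> carrier binary_octahedral" if "p permutes {1..4}" for p
    using that finite_atLeastAtMost
  proof (induction rule: permutes_induct)
    case id
    show ?case using oct.one_closed unfolding one_binary_octahedral by blast
  next
    case (swap i j p)
    then obtain A where "(A, p) \<in> carrier binary_octahedral" by blast
    from oct.m_closed[OF transposition_in_binary_octahedral[OF swap(1-3)] this]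
    show ?case unfolding mult_binary_octahedral by blast
  qed
  then show "carrier (sym_group 4) \<subseteq> snd ` carrier binary_octahedral"
    by (force simp: sym_group_def)
qed

lemma kernel_snd: "kernel binary_octahedral (sym_group 4) snd = {(mat 1, id), (- mat 1, id)}"
proof -
  have "det (- mat 1 :: 7 ^ 2 ^ 2) = 1" by (simp add: mat_eq_mat2)
  then have "(- mat 1, id) \<in> carrier binary_octahedral" "(mat 1, id) \<in> carrier binary_octahedral"
    by (auto simp: binary_octahedral_def moves_diagonals_def minus_matrix_mult permutes_id)
  then show ?thesis
    unfolding kernel_def sym_group_one
    by (auto simp del: id_apply dest: trivial_perm_imp_central)
qed

text \<open>
  Kernels are moved along isomorphisms by composing the homomorphism that defines them. The two
  extensions are recognised in isomorphic copies of the groups in this way.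
\<close>
lemma card_kernel_comp_iso:
  assumes "f \<in> iso G H"
  shows "card (kernel G K (g \<circ> f)) = card (kernel H K g)"
proof (rule bij_betw_same_card)
  have f: "inj_on f (carrier G)" "f ` carrier G = carrier H"
    using assms by (auto simp: iso_def bij_betw_def)
  have "f ` kernel G K (g \<circ> f) = kernel H K g"
    unfolding kernel_def f(2)[symmetric] by auto
  moreover have "inj_on f (kernel G K (g \<circ> f))"
    using f(1) by (rule inj_on_subset) (auto simp: kernel_def)
  ultimately show "bij_betw f (kernel G K (g \<circ> f)) (kernel H K g)"
    by (simp add: bij_betw_def)
qed

lemma image_comp_iso:
  assumes "f \<in> iso G H"
  shows "(g \<circ> f) ` carrier G = g ` carrier H"
  unfolding image_comp[symmetric] using assms by (simp add: iso_def bij_betw_def)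

lemma is_2_dot_S4I:
  assumes "group H" "f \<in> hom H (sym_group 4)" "f ` carrier H = carrier (sym_group 4)"
    and "card (kernel H (sym_group 4) f) = 2"
  shows "is_2_dot_S4 H"
proof -
  interpret group_hom H "sym_group 4" f
    using assms sym_group_is_group by (simp add: group_hom_def group_hom_axioms_def)
  show ?thesis
    unfolding is_2_dot_S4_def using assms normal_kernel FactGroup_iso by blast
qed

lemma is_2_dot_S4_binary_octahedral:
  assumes "group H" "f \<in> iso H binary_octahedral"
  shows "is_2_dot_S4 H"
proof (rule is_2_dot_S4I[where f = "snd \<circ> f"])
  show "snd \<circ> f \<in> hom H (sym_group 4)"
    using hom_compose[OF _ snd_hom] assms(2) by (auto simp: iso_def)
  show "(snd \<circ> f) ` carrier H = carrier (sym_group 4)"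
    using image_comp_iso[OF assms(2)] snd_surj by metis
  show "card (kernel H (sym_group 4) (snd \<circ> f)) = 2"
    unfolding card_kernel_comp_iso[OF assms(2)] by (simp add: kernel_snd mat_eq_mat2)
qed fact

section \<open>Orders and fixed points in the binary octahedral group\<close>

text \<open>
  7 does not divide 24; numerically, \<open>7 \<cdot> 7 - 2 \<cdot> 24 = 1\<close>.
\<close>
lemma sym_group_4_no_order_7:
  assumes "p \<in> carrier (sym_group 4)" "p [^]\<^bsub>sym_group 4\<^esub> (7 :: nat) = id"
  shows "p = id"
proof -
  interpret group "sym_group 4" by (rule sym_group_is_group)
  have "order (sym_group 4) = 24"
    by (simp add: order_def sym_group_card_carrier fact_numeral)
  then have "ord p dvd 24" "ord p dvd 7"
    using ord_dvd_group_order[OF assms(1)] assms pow_eq_id[OF assms(1), of 7] by (simp_all add: sym_group_one)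
  then have "ord p dvd 7 * 7 - 2 * 24" by (intro dvd_diff_nat dvd_mult) auto
  then show ?thesis using ord_eq_1[OF assms(1)] by (simp add: sym_group_one)
qed

text \<open>
  The trace condition says that 1 is not an eigenvalue. A matrix of trace 2 or \<open>-2\<close> in \<open>SL(2,7)\<close>
  has its seventh power equal to 1 or \<open>-1\<close>; the seventh power of its permutation is then trivial,
  hence the permutation itself is, and the matrix is 1 or \<open>-1\<close>. In all other cases the exponent is
  read off from the trace.
\<close>
lemma binary_octahedral_exponents:
  assumes "(mat2 a b c d, p) \<in> carrier binary_octahedral"
    and "(mat2 a b c d, p) \<noteq> \<one>\<^bsub>binary_octahedral\<^esub>"
  shows "a + d \<noteq> 2"
    and "\<exists>n \<in> {6, 8 :: nat}. (mat2 a b c d, p) [^]\<^bsub>binary_octahedral\<^esub> n = \<one>\<^bsub>binary_octahedral\<^esub>"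
proof -
  let ?A = "mat2 a b c d"
  have det: "a * d - b * c = 1" and p: "p \<in> carrier (sym_group 4)"
    using assms by (auto simp: binary_octahedral_def sym_group_def)
  have closed: "(?A [^]\<^bsub>GL\<^esub> n, p [^]\<^bsub>sym_group 4\<^esub> n) \<in> carrier binary_octahedral" for n :: nat
    using oct.nat_pow_closed[OF assms(1)] by (simp add: binary_octahedral_pow)
  \<comment> \<open>Elements of order 7 and 14, which \<open>SL(2,7)\<close> has in these traces, are excluded by the permutation.\<close>
  have central: "?A = - mat 1 \<and> p = id" if "a + d \<in> {2, - 2}"
  proof -
    have "Suc 6 = 7" by simp
    have "?A [^]\<^bsub>GL\<^esub> (7 :: nat) = mat 1 \<or> ?A [^]\<^bsub>GL\<^esub> (7 :: nat) = - mat 1"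
      using mat2_pow_scalar[of a d b c 6, unfolded det \<open>Suc 6 = 7\<close>] lucas_det_one(2)[OF that]
      by (auto simp: mat_eq_mat2)
    then have "p [^]\<^bsub>sym_group 4\<^esub> (7 :: nat) = id"
      using central_imp_trivial_perm closed by blast
    then have "p = id" by (rule sym_group_4_no_order_7[OF p])
    then show ?thesis
      using trivial_perm_imp_central assms by (auto simp: one_binary_octahedral)
  qed
  show tr: "a + d \<noteq> 2"
  proof
    assume "a + d = 2"
    with central have "mat2 a b c d = - mat 1" by simp
    then have "a = - 1" "d = - 1" by (simp_all add: mat_eq_mat2)
    with \<open>a + d = 2\<close> show False by simp
  qed
  show "\<exists>n \<in> {6, 8 :: nat}. (?A, p) [^]\<^bsub>binary_octahedral\<^esub> n = \<one>\<^bsub>binary_octahedral\<^esub>"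
  \<comment> \<open>The element with matrix \<open>-1\<close> has order 2, which is covered by the exponent 6.\<close>
  proof (cases "a + d = - 2")
    case True
    with central have "(?A, p) = (- mat 1, id)" by simp
    then have "(?A, p) [^]\<^bsub>binary_octahedral\<^esub> (2 :: nat) = \<one>\<^bsub>binary_octahedral\<^esub>"
      by (simp add: binary_octahedral_def numeral_2_eq_2 minus_matrix_mult)
    then have "(?A, p) [^]\<^bsub>binary_octahedral\<^esub> (6 :: nat) = \<one>\<^bsub>binary_octahedral\<^esub>"
      using oct.nat_pow_pow[OF assms(1), of 2 3] by simp
    then show ?thesis by blast
  next
    case False
    then obtain n where n: "n \<in> {5, 7}" "lucas (a + d) 1 (Suc n) = 0" "lucas (a + d) 1 n = - 1"
      using lucas_det_one(1)[of "a + d"] tr by blast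
    have "?A [^]\<^bsub>GL\<^esub> Suc n = mat 1"
      using mat2_pow_scalar[of a d b c n] n by (simp add: det)
    moreover from this have "p [^]\<^bsub>sym_group 4\<^esub> Suc n = id"
      using central_imp_trivial_perm closed by metis
    ultimately have "(?A, p) [^]\<^bsub>binary_octahedral\<^esub> Suc n = \<one>\<^bsub>binary_octahedral\<^esub>"
      by (simp only: binary_octahedral_pow one_binary_octahedral)
    moreover have "Suc n \<in> {6, 8}" using n(1) by auto
    ultimately show ?thesis by blast
  qed
qed

text \<open>
  In determinant 1 one has \<open>det (1 - A) = 2 - tr A\<close>, so \<open>1 - A\<close> is invertible.
\<close>
lemma fixed_point_free:
  fixes a b c d :: 7
  assumes "a * d - b * c = 1" "a + d \<noteq> 2" "mat2 a b c d *v w = w"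
  shows "w = 0"
proof -
  obtain x y where w: "w = vector [x, y]"
    using that[of "w $ 1" "w $ 2"] by (simp add: vec_eq_iff forall_2)
  then have xy: "a * x + b * y = x" "c * x + d * y = y"
    using assms(3) unfolding w mat2_vec by (simp_all add: vec_eq_iff forall_2)
  have "2 - (a + d) \<noteq> 0" using assms(2) by auto
  then obtain e where e: "(2 - (a + d)) * e = 1" using F7_field by blast
  have ad: "a * (d * z) = z + b * (c * z)" for z
  proof -
    have "a * (d * z) = (a * d - b * c) * z + b * (c * z)" by (simp add: algebra_simps)
    then show ?thesis by (simp add: assms(1))
  qed
  \<comment> \<open>The adjugate of \<open>A - 1\<close>, applied to the vector \<open>(A - 1) w\<close>.\<close>
  have *: "(2 - (a + d)) * x = (d - 1) * (a * x + b * y - x) - b * (c * x + d * y - y)"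
    "(2 - (a + d)) * y = (a - 1) * (c * x + d * y - y) - c * (a * x + b * y - x)"
    by (simp_all add: algebra_simps ad)
  then have "(2 - (a + d)) * x = 0" "(2 - (a + d)) * y = 0"
    unfolding xy by simp_all
  moreover have "z = 0" if "(2 - (a + d)) * z = 0" for z
  proof -
    have "z = e * ((2 - (a + d)) * z)"
      using e by (simp add: mult.commute[of e] flip: mult.assoc)
    then show ?thesis using that by simp
  qed
  ultimately have "x = 0" "y = 0" by blast+
  then show ?thesis by (simp add: w vec_eq_iff forall_2)
qed

text \<open>
  The products of the half turns along \<open>(1 2) (2 3)\<close> and \<open>(1 2) (2 3) (3 4)\<close> induce a 3-cycle and a
  4-cycle of the diagonals. The order of a lift is decided by its trace, which is 1 for the
  first and 3 or \<open>-3\<close> for the second.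
\<close>
lemma binary_octahedral_orders:
  obtains x y where "x \<in> carrier binary_octahedral" "y \<in> carrier binary_octahedral"
    "oct.ord x = 6" "oct.ord y = 8"
proof -
  let ?t = "\<lambda>i j. (mat 2 ** (diagonal i - diagonal j), Transposition.transpose i j)"
  have t: "?t i j \<in> carrier binary_octahedral" if "i \<in> {1..4}" "j \<in> {1..4}" "i \<noteq> j" for i j
    using transposition_in_binary_octahedral[OF that] .
  define x where "x = ?t 1 2 \<otimes>\<^bsub>binary_octahedral\<^esub> ?t 2 3"
  define y where "y = x \<otimes>\<^bsub>binary_octahedral\<^esub> ?t 3 4"
  have x: "x \<in> carrier binary_octahedral" and y: "y \<in> carrier binary_octahedral"
    unfolding x_def y_def by (intro oct.m_closed t; simp)+
  have iff: "z [^]\<^bsub>binary_octahedral\<^esub> n = \<one>\<^bsub>binary_octahedral\<^esub> \<longleftrightarrow> fst z [^]\<^bsub>GL\<^esub> n = mat 1"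
    if z: "z \<in> carrier binary_octahedral" for z and n :: nat
  proof -
    have "z [^]\<^bsub>binary_octahedral\<^esub> n \<in> carrier binary_octahedral" using z by simp
    then show ?thesis
      using central_imp_trivial_perm binary_octahedral_pow[of "fst z" "snd z" n] by (auto simp: one_binary_octahedral)
  qed
  obtain a b c d where X: "fst x = mat2 a b c d" "a + d = 1" "a * d - b * c = 1"
    by (rule that[of "fst x $ 1 $ 1" "fst x $ 1 $ 2" "fst x $ 2 $ 1" "fst x $ 2 $ 2"])
       (simp_all add: x_def binary_octahedral_def mat_eq_mat2, simp_all add: mat2_def)
  have "oct.ord x = 6"
    by (rule oct.ord_eq_6_7_8(1)[OF x]; unfold iff[OF x] X(1) mat2_pow_numeral X(2,3))
      (use X(2,3) in \<open>auto simp: numeral_eq_Suc mat_eq_mat2\<close>)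
  obtain a b c d where Y: "fst y = mat2 a b c d" "a + d = 3 \<or> a + d = 4" "a * d - b * c = 1"
    by (rule that[of "fst y $ 1 $ 1" "fst y $ 1 $ 2" "fst y $ 2 $ 1" "fst y $ 2 $ 2"])
       (simp_all add: x_def y_def binary_octahedral_def mat_eq_mat2, simp_all add: mat2_def)
  have Suc: "Suc 3 = 4" "Suc 7 = 8" by simp_all
  have "lucas (a + d) 1 4 = 0 \<and> lucas (a + d) 1 3 = 1 \<and> lucas (a + d) 1 8 = 0 \<and> lucas (a + d) 1 7 = - 1"
    using Y(2) by (auto simp: numeral_eq_Suc)
  then have "fst y [^]\<^bsub>GL\<^esub> (4 :: nat) = mat (- 1)" "fst y [^]\<^bsub>GL\<^esub> (8 :: nat) = mat 1"
    using mat2_pow_scalar[of a d b c 3, unfolded Y(3) Suc] mat2_pow_scalar[of a d b c 7, unfolded Y(3) Suc]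
    unfolding Y(1) by auto
  then have "oct.ord y = 8"
    by (intro oct.ord_eq_6_7_8(3)[OF y]; unfold iff[OF y]) (simp_all add: mat_eq_mat2)
  show ?thesis using that x y \<open>oct.ord x = 6\<close> \<open>oct.ord y = 8\<close> by blast
qed

section \<open>Frobenius groups with binary octahedral complement\<close>

text \<open>
  The semidirect product of \<open>V\<^sup>k\<close> with the binary octahedral group acting diagonally. Vectors of
  length \<open>k\<close> are functions that vanish from \<open>k\<close> on, so that all \<open>k\<close> share one type.
\<close>
definition frobenius_group :: "nat \<Rightarrow> ((nat \<Rightarrow> 7 ^ 2) \<times> (7 ^ 2 ^ 2) \<times> (nat \<Rightarrow> nat)) monoid" where
  "frobenius_group k =
     \<lparr>carrier = {v. \<forall>i \<ge> k. v i = 0} \<times> carrier binary_octahedral,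
      mult = (\<lambda>(v, g) (w, h). (\<lambda>i. v i + fst g *v w i, g \<otimes>\<^bsub>binary_octahedral\<^esub> h)),
      one = (\<lambda>_. 0, \<one>\<^bsub>binary_octahedral\<^esub>)\<rparr>"

lemma group_frobenius_group: "group (frobenius_group k)"
proof (rule groupI)
  fix x assume "x \<in> carrier (frobenius_group k)"
  then obtain v g where x: "x = (v, g)" "\<forall>i \<ge> k. v i = 0" "g \<in> carrier binary_octahedral"
    by (auto simp: frobenius_group_def)
  define h where "h = inv\<^bsub>binary_octahedral\<^esub> g"
  have "h \<in> carrier binary_octahedral" "h \<otimes>\<^bsub>binary_octahedral\<^esub> g = \<one>\<^bsub>binary_octahedral\<^esub>"
    using x(3) by (simp_all add: h_def)
  then show "\<exists>y \<in> carrier (frobenius_group k). y \<otimes>\<^bsub>frobenius_group k\<^esub> x = \<one>\<^bsub>frobenius_group k\<^esub>"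
    using x by (intro bexI[of _ "(\<lambda>i. - (fst h *v v i), h)"]) (auto simp: frobenius_group_def)
qed (auto simp: frobenius_group_def oct.m_assoc fst_mult_binary_octahedral fst_one_binary_octahedral
       matrix_vector_right_distrib matrix_vector_mul_assoc add.assoc simp del: split_paired_All)

lemma card_bounded_support:
  "card {v :: nat \<Rightarrow> 'a::{finite, zero}. \<forall>i \<ge> k. v i = 0} = CARD('a) ^ k"
  "finite {v :: nat \<Rightarrow> 'a. \<forall>i \<ge> k. v i = 0}"
proof -
  have "bij_betw (\<lambda>v. restrict v {..<k}) {v :: nat \<Rightarrow> 'a. \<forall>i \<ge> k. v i = 0} (PiE {..<k} (\<lambda>_. UNIV))"
    by (rule bij_betwI[where g = "\<lambda>v i. if i < k then v i else 0"])
       (auto simp: fun_eq_iff PiE_iff extensional_def)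
  moreover have "card (PiE {..<k} (\<lambda>_. UNIV :: 'a set)) = CARD('a) ^ k" by (simp add: card_PiE)
  moreover have "finite (PiE {..<k} (\<lambda>_. UNIV :: 'a set))" by (simp add: finite_PiE)
  ultimately show "card {v :: nat \<Rightarrow> 'a. \<forall>i \<ge> k. v i = 0} = CARD('a) ^ k"
    "finite {v :: nat \<Rightarrow> 'a. \<forall>i \<ge> k. v i = 0}"
    by (simp_all add: bij_betw_same_card bij_betw_finite)
qed

lemma finite_frobenius_group: "finite (carrier (frobenius_group k))"
  by (simp add: frobenius_group_def card_bounded_support finite_binary_octahedral)

lemma order_frobenius_group: "order (frobenius_group k) = 49 ^ k * order binary_octahedral"
  by (simp add: order_def frobenius_group_def card_cartesian_product card_bounded_support)

lemma frobenius_projection: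
  "snd \<in> hom (frobenius_group k) binary_octahedral"
  "snd ` carrier (frobenius_group k) = carrier binary_octahedral"
  "card (kernel (frobenius_group k) binary_octahedral snd) = 7 ^ (2 * k)"
proof -
  show "snd \<in> hom (frobenius_group k) binary_octahedral"
    by (auto simp: hom_def frobenius_group_def)
  have "(\<lambda>_. 0) \<in> {v :: nat \<Rightarrow> 7 ^ 2. \<forall>i \<ge> k. v i = 0}" by simp
  then show "snd ` carrier (frobenius_group k) = carrier binary_octahedral"
    unfolding frobenius_group_def by force
  have "kernel (frobenius_group k) binary_octahedral snd
      = {v. \<forall>i \<ge> k. v i = 0} \<times> {\<one>\<^bsub>binary_octahedral\<^esub>}"
    by (auto simp: kernel_def frobenius_group_def)
  then show "card (kernel (frobenius_group k) binary_octahedral snd) = 7 ^ (2 * k)"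
    by (simp add: card_cartesian_product card_bounded_support power_mult)
qed

lemma frobenius_group_extension:
  assumes "group G" "f \<in> iso G (frobenius_group k)"
  obtains N where "N \<lhd> G" "finite_p_group 7 (G\<lparr>carrier := N\<rparr>)" "is_2_dot_S4 (G Mod N)"
proof -
  let ?h = "snd \<circ> f"
  interpret group_hom G binary_octahedral ?h
    using assms oct.is_group hom_compose[OF _ frobenius_projection(1)]
    by (auto simp: group_hom_def group_hom_axioms_def iso_def)
  define N where "N = kernel G binary_octahedral ?h"
  have normal: "N \<lhd> G" unfolding N_def by (rule normal_kernel)
  have "card N = 7 ^ (2 * k)"
    unfolding N_def card_kernel_comp_iso[OF assms(2)] by (rule frobenius_projection)
  moreover from this have "finite N" by (intro card_ge_0_finite) simp
  moreover have "group (G\<lparr>carrier := N\<rparr>)"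
    using normal assms(1) by (simp add: normal_imp_subgroup subgroup.subgroup_is_group)
  ultimately have "finite_p_group 7 (G\<lparr>carrier := N\<rparr>)"
    by (auto simp: finite_p_group_def order_def)
  moreover have "?h ` carrier G = carrier binary_octahedral"
    unfolding image_comp_iso[OF assms(2)] by (rule frobenius_projection)
  then have "is_2_dot_S4 (G Mod N)"
    unfolding N_def
    using FactGroup_iso_set is_2_dot_S4_binary_octahedral normal.factorgroup_is_group[OF normal_kernel] by blast
  ultimately show ?thesis using that normal by blast
qed

lemma one_frobenius_group: "\<one>\<^bsub>frobenius_group k\<^esub> = (\<lambda>_. 0, \<one>\<^bsub>binary_octahedral\<^esub>)"
  by (simp add: frobenius_group_def)

lemma frobenius_pow_translation:
  "(v, \<one>\<^bsub>binary_octahedral\<^esub>) [^]\<^bsub>frobenius_group k\<^esub> (n :: nat) = (\<lambda>i. of_nat n *s v i, \<one>\<^bsub>binary_octahedral\<^esub>)"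
  by (induction n) (simp_all add: frobenius_group_def fst_one_binary_octahedral vec_eq_iff algebra_simps fun_eq_iff)

lemma frobenius_pow_complement:
  "(\<lambda>_. 0, g) [^]\<^bsub>frobenius_group k\<^esub> (n :: nat) = (\<lambda>_. 0, g [^]\<^bsub>binary_octahedral\<^esub> n)"
  by (induction n) (simp_all add: frobenius_group_def)

text \<open>
  Let \<open>x\<close> lie outside \<open>V\<^sup>k\<close> and let \<open>n\<close> kill its component in the complement. Then \<open>x\<^sup>n\<close> is a
  vector that commutes with \<open>x\<close>, so it is fixed by the component of \<open>x\<close> in the complement, and
  hence zero. Elements of \<open>V\<^sup>k\<close> are killed by 7.
\<close>
lemma spectrum_frobenius_group:
  assumes "k > 0"
  shows "spectrum (frobenius_group k) = {n. \<exists>m \<in> {6, 7, 8}. n dvd m}"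
proof (rule spectrum_6_7_8)
  show "group (frobenius_group k)" by (rule group_frobenius_group)
  interpret group "frobenius_group k" by (rule group_frobenius_group)
  fix x assume x: "x \<in> carrier (frobenius_group k)"
  then obtain v g where vg: "x = (v, g)" "g \<in> carrier binary_octahedral"
    by (auto simp: frobenius_group_def)
  show "\<exists>n \<in> {6, 7, 8 :: nat}. x [^]\<^bsub>frobenius_group k\<^esub> n = \<one>\<^bsub>frobenius_group k\<^esub>"
  proof (cases "g = \<one>\<^bsub>binary_octahedral\<^esub>")
    case True
    have "of_nat 7 = (0 :: 7)" by simp
    then have "x [^]\<^bsub>frobenius_group k\<^esub> (7 :: nat) = \<one>\<^bsub>frobenius_group k\<^esub>"
      unfolding vg True frobenius_pow_translation one_frobenius_group
      by (simp only: vector_smult_lzero)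
    then show ?thesis by blast
  next
    case False
    obtain a b c d p where g: "g = (mat2 a b c d, p)"
      using mat2_exhaust by (metis surj_pair)
    obtain n :: nat where n: "n \<in> {6, 8}" "g [^]\<^bsub>binary_octahedral\<^esub> n = \<one>\<^bsub>binary_octahedral\<^esub>"
      using binary_octahedral_exponents(2)[OF vg(2)[unfolded g] False[unfolded g]] unfolding g by blast
    have free: "w = 0" if "mat2 a b c d *v w = w" for w
      using that binary_octahedral_exponents(1) vg(2) False
      unfolding g by (intro fixed_point_free) (auto simp: binary_octahedral_def)
    have "snd (x [^]\<^bsub>frobenius_group k\<^esub> n) = \<one>\<^bsub>binary_octahedral\<^esub>"
      using hom_nat_pow[OF frobenius_projection(1) x is_group oct.is_group, of n] n(2) vg by simp
    then obtain w where w: "x [^]\<^bsub>frobenius_group k\<^esub> n = (w, \<one>\<^bsub>binary_octahedral\<^esub>)"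
      by (metis prod.collapse)
    have "x \<otimes>\<^bsub>frobenius_group k\<^esub> (w, \<one>\<^bsub>binary_octahedral\<^esub>) = (w, \<one>\<^bsub>binary_octahedral\<^esub>) \<otimes>\<^bsub>frobenius_group k\<^esub> x"
      unfolding w[symmetric] using x nat_pow_comm[of x n 1] by simp
    then have "\<forall>i. mat2 a b c d *v w i = w i"
      by (auto simp: vg g frobenius_group_def fst_one_binary_octahedral fun_eq_iff add.commute)
    then have "w = (\<lambda>_. 0)" using free by auto
    then show ?thesis using n(1) w by (auto simp: one_frobenius_group)
  qed
next
  interpret group "frobenius_group k" by (rule group_frobenius_group)
  define v :: "nat \<Rightarrow> 7 ^ 2" where "v = (\<lambda>i. if i = 0 then vector [1, 0] else 0)"
  let ?v = "(v, \<one>\<^bsub>binary_octahedral\<^esub>)"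
  have v: "?v \<in> carrier (frobenius_group k)"
    using assms by (auto simp: frobenius_group_def v_def)
  have "v 0 $ 1 \<noteq> 0" by (simp add: v_def)
  then have "v \<noteq> (\<lambda>_. 0)" by auto
  moreover have "of_nat 7 = (0 :: 7)" by simp
  ultimately have "ord ?v = 7"
    by (intro ord_eq_6_7_8(2)[OF v])
       (simp_all only: frobenius_pow_translation one_frobenius_group vector_smult_lzero, simp)
  obtain x y where xy: "x \<in> carrier binary_octahedral" "y \<in> carrier binary_octahedral"
    "oct.ord x = 6" "oct.ord y = 8" by (rule binary_octahedral_orders)
  have compl: "(\<lambda>_. 0, g) \<in> carrier (frobenius_group k)" "ord (\<lambda>_. 0, g) = oct.ord g"
    if "g \<in> carrier binary_octahedral" for g
  proof -
    show c: "(\<lambda>_. 0, g) \<in> carrier (frobenius_group k)" using that by (simp add: frobenius_group_def)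
    show "ord (\<lambda>_. 0, g) = oct.ord g"
      unfolding ord_unique[OF c] using that
      by (simp add: frobenius_pow_complement one_frobenius_group oct.pow_eq_id)
  qed
  have "ord z \<in> spectrum (frobenius_group k)" if "z \<in> carrier (frobenius_group k)" for z
    using that unfolding spectrum_def by blast
  from this[OF v] this[OF compl(1)[OF xy(1)]] this[OF compl(1)[OF xy(2)]]
  show "{6, 7, 8} \<subseteq> spectrum (frobenius_group k)"
    by (simp add: \<open>ord ?v = 7\<close> compl(2) xy)
qed

section \<open>Nonrecognizability of PGL(2,7)\<close>

theorem theorem3:
  shows "(\<exists>G :: nat monoid. group G \<and> finite (carrier G) \<and>
            (\<exists>N. N \<lhd> G \<and> finite_p_group 7 (G\<lparr>carrier := N\<rparr>) \<and> is_2_dot_S4 (G Mod N)) \<and>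
            mu G = mu PGL_2_7) \<and>
         mu PGL_2_7 = {6, 7, 8} \<and>
         nonrecognizable PGL_2_7"
proof -
  \<comment> \<open>The rank is at least 1, since for rank 0 there is no element of order 7.\<close>
  have "\<exists>G :: nat monoid. group G \<and> finite (carrier G) \<and> frobenius_group (Suc k) \<cong> G" for k
    by (intro nat_copy_exists group_frobenius_group finite_frobenius_group)
  then obtain G :: "nat \<Rightarrow> nat monoid"
    where G: "\<And>k. group (G k)" "\<And>k. finite (carrier (G k))" "\<And>k. frobenius_group (Suc k) \<cong> G k"
    by metis
  have spectrum: "spectrum (G k) = {n. \<exists>m \<in> {6, 7, 8}. n dvd m}" for k
    using spectrum_iso[OF group_frobenius_group G(1) G(3)] spectrum_frobenius_group[of "Suc k"] by simp
  have G0: "\<exists>N. N \<lhd> G 0 \<and> finite_p_group 7 (G 0\<lparr>carrier := N\<rparr>) \<and> is_2_dot_S4 (G 0 Mod N)"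
    using group.iso_sym[OF group_frobenius_group G(3)] frobenius_group_extension[OF G(1)]
    unfolding is_iso_def by blast
  let ?R = "{(H, K). H \<in> isospectral_groups PGL_2_7 \<and> K \<in> isospectral_groups PGL_2_7 \<and> H \<cong> K}"
  have iso: "G k \<in> isospectral_groups PGL_2_7" for k
    using G spectrum spectrum_PGL_2_7 by (simp add: isospectral_groups_def)
  \<comment> \<open>The classes are told apart by the orders of the groups.\<close>
  have "inj (\<lambda>k. ?R `` {G k})"
  proof (rule injI)
    fix k l assume "?R `` {G k} = ?R `` {G l}"
    then have "(G k, G l) \<in> ?R"
      using eq_equiv_class[OF _ equiv_isospectral iso] by blast
    then have "G k \<cong> G l" by simp
    then have "order (G k) = order (G l)"
      by (simp add: order_def iso_same_card)
    moreover have "order (G k) = order (frobenius_group (Suc k))" for k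
      using iso_same_card[OF G(3)] by (simp add: order_def)
    moreover have "order binary_octahedral > 0"
      using finite_binary_octahedral oct.order_gt_0_iff_finite by blast
    ultimately have "(49 :: nat) ^ Suc k = 49 ^ Suc l"
      by (simp add: order_frobenius_group)
    then show "k = l" by simp
  qed
  moreover have "range (\<lambda>k. ?R `` {G k}) \<subseteq> isospectral_classes PGL_2_7"
    using iso unfolding isospectral_classes_def quotient_def by blast
  ultimately have "infinite (isospectral_classes PGL_2_7)"
    using infinite_super range_inj_infinite by blast
  then have "nonrecognizable PGL_2_7"
    by (simp add: nonrecognizable_def num_isospectral_def)
  moreover have "mu (G 0) = mu PGL_2_7"
    using mu_6_7_8[OF spectrum] mu_6_7_8[OF spectrum_PGL_2_7] by simp
  ultimately show ?thesis
    using G G0 mu_6_7_8[OF spectrum_PGL_2_7] by blast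
qed

end
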